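(* Let $k$ be a field of characteristic $0$ and let $A=\langle k[x],\circ\rangle$ be the Novikov algebra on the space of polynomials $k[x]$ with multiplication $f\circ g=\partial(f)g$, where $\partial=\frac{d}{dx}$. Then $A$ does not satisfy any nontrivial Novikov identity; that is, for every $n\ge 1$ and every nonzero element $g$ of the free Novikov algebra $\mathrm{N}\langle x_1,\ldots,x_n\rangle$ over $k$ there is a homomorphism of Novikov $k$-algebras $\varphi:\mathrm{N}\langle x_1,\ldots,x_n\rangle\to A$ with $\varphi(g)\neq 0$.
   Context: Algebras are $k$-vector spaces with a $k$-bilinear multiplication, not assumed associative or unital. A Novikov algebra is an algebra satisfying the identities $(xy)z-x(yz)=(xz)y-x(zy)$ and $x(yz)=y(xz)$. The free Novikov algebra $\mathrm{N}\langle x_1,\ldots,x_n\rangle$ is the free (non-unital) algebra on $x_1,\ldots,x_n$ in the variety of Novikov algebras over $k$. A nontrivial Novikov identity is an identity $g=0$ where $g$ is a nonzero element of a free Novikov algebra $\mathrm{N}\langle x_1,\ldots,x_n\rangle$; an algebra $B$ satisfies it if $g$ is sent to $0$ by every homomorphism $\mathrm{N}\langle x_1,\ldots,x_n\rangle\to B$. *)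

theory Defs
  imports "HOL-Library.Poly_Mapping" "HOL-Computational_Algebra.Polynomial"
begin

locale nonassoc_algebra = vector_space scale
  for scale :: "'k::field \<Rightarrow> 'a::ab_group_add \<Rightarrow> 'a" +
  fixes mult :: "'a \<Rightarrow> 'a \<Rightarrow> 'a"
  assumes mult_add_left: "mult (a + b) c = mult a c + mult b c"
    and mult_add_right: "mult a (b + c) = mult a b + mult a c"
    and mult_scale_left: "mult (scale r a) b = scale r (mult a b)"
    and mult_scale_right: "mult a (scale r b) = scale r (mult a b)"
begin

lemma mult_0_left [simp]: "mult 0 b = 0"
  using mult_add_left[of 0 0 b] by simp

lemma mult_0_right [simp]: "mult a 0 = 0"
  using mult_add_right[of a 0 0] by simp

lemma mult_sum_left: "mult (sum f A) b = (\<Sum>i\<in>A. mult (f i) b)"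
  by (induction A rule: infinite_finite_induct) (auto simp: mult_add_left)

lemma mult_sum_right: "mult a (sum f A) = (\<Sum>i\<in>A. mult a (f i))"
  by (induction A rule: infinite_finite_induct) (auto simp: mult_add_right)

lemma mult_minus_left: "mult (- a) b = - mult a b"
  using mult_add_left[of a "- a" b] by (simp add: eq_neg_iff_add_eq_0 add.commute)

lemma mult_minus_right: "mult a (- b) = - mult a b"
  using mult_add_right[of a b "- b"] by (simp add: eq_neg_iff_add_eq_0 add.commute)

lemma mult_diff_left: "mult (a - b) c = mult a c - mult b c"
  using mult_add_left[of a "- b" c] by (simp add: mult_minus_left)

lemma mult_diff_right: "mult a (b - c) = mult a b - mult a c"
  using mult_add_right[of a b "- c"] by (simp add: mult_minus_right)

end

locale novikov_algebra = nonassoc_algebra scale mult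
  for scale :: "'k::field \<Rightarrow> 'a::ab_group_add \<Rightarrow> 'a" and mult +
  assumes right_symmetric:
      "mult (mult x y) z - mult x (mult y z) = mult (mult x z) y - mult x (mult z y)"
    and left_commutative: "mult x (mult y z) = mult y (mult x z)"

locale novikov_hom =
  A: novikov_algebra scaleA multA + B: novikov_algebra scaleB multB + Vector_Spaces.linear scaleA scaleB \<phi>
  for scaleA :: "'k::field \<Rightarrow> 'a::ab_group_add \<Rightarrow> 'a" and multA
    and scaleB :: "'k \<Rightarrow> 'b::ab_group_add \<Rightarrow> 'b" and multB
    and \<phi> :: "'a \<Rightarrow> 'b" +
  assumes hom_mult: "\<phi> (multA a b) = multB (\<phi> a) (\<phi> b)"

datatype 'v magma_term = Var 'v | Mul "'v magma_term" "'v magma_term"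

text \<open>The free non-unital nonassociative algebra over \<open>'k\<close> on the letters \<open>'v\<close> is the space of
  finitely supported functions \<open>'v magma_term \<Rightarrow>\<^sub>0 'k\<close>; its product extends \<^const>\<open>Mul\<close>
  bilinearly. (The convolution product of \<^theory>\<open>HOL-Library.Poly_Mapping\<close> is not used, as it
  presupposes an additive monoid of monomials.)\<close>

definition na_scale :: "'k::field \<Rightarrow> ('a \<Rightarrow>\<^sub>0 'k) \<Rightarrow> ('a \<Rightarrow>\<^sub>0 'k)" where
  "na_scale c p = Poly_Mapping.map ((*) c) p"

definition na_mult ::
    "('v magma_term \<Rightarrow>\<^sub>0 'k::field) \<Rightarrow> ('v magma_term \<Rightarrow>\<^sub>0 'k) \<Rightarrow> ('v magma_term \<Rightarrow>\<^sub>0 'k)" where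
  "na_mult p q = (\<Sum>s\<in>Poly_Mapping.keys p. \<Sum>t\<in>Poly_Mapping.keys q.
     Poly_Mapping.single (Mul s t) (Poly_Mapping.lookup p s * Poly_Mapping.lookup q t))"

lemma lookup_na_scale [simp]:
  "Poly_Mapping.lookup (na_scale c p) t = c * Poly_Mapping.lookup p t"
  by (auto simp: na_scale_def Poly_Mapping.map.rep_eq when_def)

interpretation na: vector_space na_scale
  by unfold_locales (auto intro!: poly_mapping_eqI simp: lookup_add algebra_simps)

definition (in vector_space) lin_ext :: "('c \<Rightarrow> 'b) \<Rightarrow> ('c \<Rightarrow>\<^sub>0 'a) \<Rightarrow> 'b" where
  "lin_ext f p = (\<Sum>t\<in>Poly_Mapping.keys p. scale (Poly_Mapping.lookup p t) (f t))"

context vector_space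
begin

lemma lin_ext_superset:
  assumes "finite S" "Poly_Mapping.keys p \<subseteq> S"
  shows "lin_ext f p = (\<Sum>t\<in>S. scale (Poly_Mapping.lookup p t) (f t))"
  unfolding lin_ext_def
  by (rule sum.mono_neutral_left) (use assms in \<open>auto simp: in_keys_iff\<close>)

lemma lin_ext_add: "lin_ext f (p + q) = lin_ext f p + lin_ext f q"
proof -
  let ?S = "Poly_Mapping.keys p \<union> Poly_Mapping.keys q"
  have "Poly_Mapping.keys (p + q) \<subseteq> ?S"
    by (rule Poly_Mapping.keys_add)
  then show ?thesis
    by (simp add: lin_ext_superset[of ?S] lookup_add scale_left_distrib sum.distrib)
qed

lemma lin_ext_scale: "lin_ext f (na_scale c p) = scale c (lin_ext f p)"
proof -
  have "Poly_Mapping.keys (na_scale c p) \<subseteq> Poly_Mapping.keys p"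
    by (auto simp: in_keys_iff)
  then show ?thesis
    by (simp add: lin_ext_superset[of "Poly_Mapping.keys p"] scale_sum_right)
qed

lemma lin_ext_single [simp]: "lin_ext f (Poly_Mapping.single t c) = scale c (f t)"
  by (simp add: lin_ext_def)

lemma linear_lin_ext: "Vector_Spaces.linear na_scale scale (lin_ext f)"
  by unfold_locales (simp_all add: lin_ext_add lin_ext_scale)

lemma lin_ext_fun_add: "lin_ext (\<lambda>t. f t + g t) p = lin_ext f p + lin_ext g p"
  by (simp add: lin_ext_def scale_right_distrib sum.distrib)

lemma lin_ext_fun_scale: "lin_ext (\<lambda>t. scale c (f t)) p = scale c (lin_ext f p)"
  by (simp add: lin_ext_def scale_sum_right mult.commute)

lemma lin_ext_unique:
  assumes "Vector_Spaces.linear na_scale scale h" "\<And>t. h (Poly_Mapping.single t 1) = f t"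
  shows "h p = lin_ext f p"
proof -
  interpret h: Vector_Spaces.linear na_scale scale h by fact
  have "p = (\<Sum>t\<in>Poly_Mapping.keys p.
      na_scale (Poly_Mapping.lookup p t) (Poly_Mapping.single t 1))"
    by (rule poly_mapping_eqI)
      (auto simp: lookup_sum lookup_single when_def in_keys_iff if_distrib cong: if_cong)
  then have "h p = h (\<Sum>t\<in>Poly_Mapping.keys p.
      na_scale (Poly_Mapping.lookup p t) (Poly_Mapping.single t 1))"
    by simp
  also have "\<dots> = lin_ext f p"
    by (simp add: h.sum h.scale assms(2) lin_ext_def)
  finally show ?thesis .
qed

end

lemma na_scale_single [simp]:
  "na_scale c (Poly_Mapping.single t d) = Poly_Mapping.single t (c * d)"
  by (rule poly_mapping_eqI) (simp add: lookup_single when_def)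

lemma na_mult_alt:
  "na_mult p q = na.lin_ext (\<lambda>s. na.lin_ext (\<lambda>t. Poly_Mapping.single (Mul s t) 1) q) p"
  by (simp add: na_mult_def na.lin_ext_def na.scale_sum_right)

lemma na_mult_single [simp]:
  "na_mult (Poly_Mapping.single s c) (Poly_Mapping.single t d)
     = Poly_Mapping.single (Mul s t) (c * d)"
  by (simp add: na_mult_alt)

interpretation na: nonassoc_algebra na_scale na_mult
  by unfold_locales
    (simp_all add: na_mult_alt na.lin_ext_add na.lin_ext_scale
      na.lin_ext_fun_add na.lin_ext_fun_scale)

text \<open>The ideal generated by all values of the two defining identities in the free
  nonassociative algebra.\<close>

inductive_set novikov_ideal :: "('v magma_term \<Rightarrow>\<^sub>0 'k::field) set" where
  right_symmetric:
    "(na_mult (na_mult x y) z - na_mult x (na_mult y z))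
       - (na_mult (na_mult x z) y - na_mult x (na_mult z y)) \<in> novikov_ideal"
| left_commutative: "na_mult x (na_mult y z) - na_mult y (na_mult x z) \<in> novikov_ideal"
| zero: "0 \<in> novikov_ideal"
| add: "p \<in> novikov_ideal \<Longrightarrow> q \<in> novikov_ideal \<Longrightarrow> p + q \<in> novikov_ideal"
| scale: "p \<in> novikov_ideal \<Longrightarrow> na_scale c p \<in> novikov_ideal"
| mult_left: "p \<in> novikov_ideal \<Longrightarrow> na_mult a p \<in> novikov_ideal"
| mult_right: "p \<in> novikov_ideal \<Longrightarrow> na_mult p a \<in> novikov_ideal"

lemma novikov_ideal_uminus: "p \<in> novikov_ideal \<Longrightarrow> - p \<in> novikov_ideal"
  using novikov_ideal.scale[of p "- 1"] by simp

lemma novikov_ideal_diff: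
  "p \<in> novikov_ideal \<Longrightarrow> q \<in> novikov_ideal \<Longrightarrow> p - q \<in> novikov_ideal"
  using novikov_ideal.add[of p "- q"] novikov_ideal_uminus[of q] by simp

definition novikov_rel ::
    "('v magma_term \<Rightarrow>\<^sub>0 'k::field) \<Rightarrow> ('v magma_term \<Rightarrow>\<^sub>0 'k) \<Rightarrow> bool" where
  "novikov_rel p q \<longleftrightarrow> p - q \<in> novikov_ideal"

lemma equivp_novikov_rel: "equivp novikov_rel"
proof (rule equivpI)
  show "reflp novikov_rel"
    by (simp add: reflp_def novikov_rel_def novikov_ideal.zero)
  show "symp novikov_rel"
    unfolding symp_def novikov_rel_def using novikov_ideal_uminus by fastforce
  show "transp novikov_rel"
    unfolding transp_def novikov_rel_def using novikov_ideal.add by fastforce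
qed

quotient_type (overloaded) ('v, 'k) free_novikov = "'v magma_term \<Rightarrow>\<^sub>0 'k::field" / novikov_rel
  by (rule equivp_novikov_rel)

instantiation free_novikov :: (type, field) ab_group_add
begin

lift_definition zero_free_novikov :: "('a, 'b) free_novikov" is 0 .

lift_definition plus_free_novikov ::
  "('a, 'b) free_novikov \<Rightarrow> ('a, 'b) free_novikov \<Rightarrow> ('a, 'b) free_novikov" is "(+)"
  unfolding novikov_rel_def by (simp only: add_diff_add novikov_ideal.add)

lift_definition uminus_free_novikov ::
  "('a, 'b) free_novikov \<Rightarrow> ('a, 'b) free_novikov" is uminus
  unfolding novikov_rel_def by (simp only: minus_diff_minus novikov_ideal_uminus)

lift_definition minus_free_novikov ::
  "('a, 'b) free_novikov \<Rightarrow> ('a, 'b) free_novikov \<Rightarrow> ('a, 'b) free_novikov" is "(-)"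
proof -
  fix p p' q q' :: "'a magma_term \<Rightarrow>\<^sub>0 'b"
  assume "novikov_rel p p'" "novikov_rel q q'"
  then have "(p - p') - (q - q') \<in> novikov_ideal"
    unfolding novikov_rel_def by (rule novikov_ideal_diff)
  then show "novikov_rel (p - q) (p' - q')"
    by (simp add: novikov_rel_def algebra_simps)
qed

instance
  by standard (transfer, simp add: novikov_rel_def novikov_ideal.zero algebra_simps)+

end

lift_definition fn_scale :: "'k::field \<Rightarrow> ('v, 'k) free_novikov \<Rightarrow> ('v, 'k) free_novikov"
  is na_scale
  unfolding novikov_rel_def by (simp only: novikov_ideal.scale flip: na.scale_right_diff_distrib)

lift_definition fn_mult ::
  "('v, 'k::field) free_novikov \<Rightarrow> ('v, 'k) free_novikov \<Rightarrow> ('v, 'k) free_novikov"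
  is na_mult
proof -
  fix p p' q q' :: "'v magma_term \<Rightarrow>\<^sub>0 'k"
  assume "novikov_rel p p'" "novikov_rel q q'"
  then have "na_mult (p - p') q + na_mult p' (q - q') \<in> novikov_ideal"
    unfolding novikov_rel_def
    by (intro novikov_ideal.add novikov_ideal.mult_left novikov_ideal.mult_right)
  then show "novikov_rel (na_mult p q) (na_mult p' q')"
    by (simp add: novikov_rel_def na.mult_diff_left na.mult_diff_right)
qed

lift_definition fn_gen :: "'v \<Rightarrow> ('v, 'k::field) free_novikov"
  is "\<lambda>v. Poly_Mapping.single (Var v) 1" .

interpretation fn: novikov_algebra fn_scale fn_mult
proof unfold_locales
  fix x y z :: "('v, 'k::field) free_novikov"
  show "fn_mult (fn_mult x y) z - fn_mult x (fn_mult y z)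
      = fn_mult (fn_mult x z) y - fn_mult x (fn_mult z y)"
    by transfer (simp only: novikov_rel_def novikov_ideal.right_symmetric)
  show "fn_mult x (fn_mult y z) = fn_mult y (fn_mult x z)"
    by transfer (simp only: novikov_rel_def novikov_ideal.left_commutative)
qed (transfer, simp add: novikov_rel_def novikov_ideal.zero na.mult_add_left na.mult_add_right
      na.mult_scale_left na.mult_scale_right na.scale_left_distrib na.scale_right_distrib)+

text \<open>Universal property: \<open>('v, 'k) free_novikov\<close> is free on the letters in the variety of
  Novikov algebras.\<close>

context novikov_algebra
begin

primrec eval_term :: "('v \<Rightarrow> 'a) \<Rightarrow> 'v magma_term \<Rightarrow> 'a" where
  "eval_term f (Var v) = f v"
| "eval_term f (Mul s t) = mult (eval_term f s) (eval_term f t)"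

lemma lin_ext_eval_term_mult:
  "lin_ext (eval_term f) (na_mult p q) = mult (lin_ext (eval_term f) p) (lin_ext (eval_term f) q)"
proof -
  interpret E: Vector_Spaces.linear na_scale scale "lin_ext (eval_term f)"
    by (rule linear_lin_ext)
  have "lin_ext (eval_term f) (na_mult p q) =
      (\<Sum>s\<in>Poly_Mapping.keys p. \<Sum>t\<in>Poly_Mapping.keys q.
        scale (Poly_Mapping.lookup p s * Poly_Mapping.lookup q t)
          (mult (eval_term f s) (eval_term f t)))"
    by (simp only: na_mult_def E.sum lin_ext_single eval_term.simps)
  also have "\<dots> = mult (lin_ext (eval_term f) p) (lin_ext (eval_term f) q)"
    unfolding lin_ext_def mult_sum_left mult_scale_left
    by (simp add: mult_sum_right mult_scale_right scale_sum_right)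
  finally show ?thesis .
qed

lemma lin_ext_eval_term_ideal:
  assumes "p \<in> novikov_ideal"
  shows "lin_ext (eval_term f) p = 0"
proof -
  interpret E: Vector_Spaces.linear na_scale scale "lin_ext (eval_term f)"
    by (rule linear_lin_ext)
  note E_simps = E.add E.diff E.scale E.zero lin_ext_eval_term_mult
  note identities = right_symmetric left_commutative
  from assms show ?thesis
  proof induction
    case (right_symmetric x y z)
    show ?case
      using identities(1)[of "lin_ext (eval_term f) x" "lin_ext (eval_term f) y"
          "lin_ext (eval_term f) z"]
      by (simp add: E_simps)
  next
    case (left_commutative x y z)
    show ?case
      using identities(2)[of "lin_ext (eval_term f) x" "lin_ext (eval_term f) y"
          "lin_ext (eval_term f) z"]
      by (simp add: E_simps)
  qed (simp_all add: E_simps)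
qed

definition fn_eval :: "('v \<Rightarrow> 'a) \<Rightarrow> ('v, 'k) free_novikov \<Rightarrow> 'a" where
  "fn_eval f a = lin_ext (eval_term f) (rep_free_novikov a)"

lemma fn_eval_abs: "fn_eval f (abs_free_novikov p) = lin_ext (eval_term f) p"
proof -
  interpret E: Vector_Spaces.linear na_scale scale "lin_ext (eval_term f)"
    by (rule linear_lin_ext)
  have "novikov_rel (rep_free_novikov (abs_free_novikov p)) p"
    by (rule Quotient_rep_abs[OF Quotient_free_novikov])
      (simp add: novikov_rel_def novikov_ideal.zero)
  then show ?thesis
    using lin_ext_eval_term_ideal[of "rep_free_novikov (abs_free_novikov p) - p" f]
    by (simp add: fn_eval_def novikov_rel_def E.diff)
qed

lemma fn_eval_gen: "fn_eval f (fn_gen v) = f v"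
  by (simp add: fn_gen.abs_eq fn_eval_abs)

lemma fn_eval_add: "fn_eval f (a + b) = fn_eval f a + fn_eval f b"
  by (induction a rule: free_novikov.abs_induct, induction b rule: free_novikov.abs_induct)
    (simp add: plus_free_novikov.abs_eq fn_eval_abs lin_ext_add)

lemma fn_eval_scale: "fn_eval f (fn_scale c a) = scale c (fn_eval f a)"
  by (induction a rule: free_novikov.abs_induct)
    (simp add: fn_scale.abs_eq fn_eval_abs lin_ext_scale)

lemma fn_eval_mult: "fn_eval f (fn_mult a b) = mult (fn_eval f a) (fn_eval f b)"
  by (induction a rule: free_novikov.abs_induct, induction b rule: free_novikov.abs_induct)
    (simp add: fn_mult.abs_eq fn_eval_abs lin_ext_eval_term_mult)

lemma novikov_hom_fn_eval: "novikov_hom fn_scale fn_mult scale mult (fn_eval f)"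
  by unfold_locales (simp_all add: fn_eval_add fn_eval_scale fn_eval_mult)

lemma fn_eval_unique:
  fixes \<phi> :: "('v, 'k) free_novikov \<Rightarrow> 'a"
  assumes hom: "novikov_hom fn_scale fn_mult scale mult \<phi>"
    and gen: "\<And>v. \<phi> (fn_gen v) = f v"
  shows "\<phi> = fn_eval f"
proof
  interpret \<phi>: novikov_hom fn_scale fn_mult scale mult \<phi> by (rule hom)
  have basis: "\<phi> (abs_free_novikov (Poly_Mapping.single t 1)) = eval_term f t" for t
  proof (induction t)
    case (Var v)
    then show ?case using gen[of v] by (simp add: fn_gen.abs_eq)
  next
    case (Mul s t)
    then show ?case
      using \<phi>.hom_mult[of "abs_free_novikov (Poly_Mapping.single s 1)"
          "abs_free_novikov (Poly_Mapping.single t 1)"]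
      by (simp add: fn_mult.abs_eq)
  qed
  have "Vector_Spaces.linear na_scale scale (\<lambda>p. \<phi> (abs_free_novikov p))"
    by unfold_locales
      (simp_all add: \<phi>.add \<phi>.scale flip: plus_free_novikov.abs_eq fn_scale.abs_eq)
  then have "\<phi> (abs_free_novikov p) = lin_ext (eval_term f) p" for p
    by (rule lin_ext_unique) (rule basis)
  then show "\<phi> a = fn_eval f a" for a
    by (induction a rule: free_novikov.abs_induct) (simp add: fn_eval_abs)
qed

theorem free_novikov_universal:
  "\<exists>!\<phi>. novikov_hom fn_scale fn_mult scale mult \<phi> \<and> (\<forall>v. \<phi> (fn_gen v) = f v)"
proof (rule ex1I)
  show "novikov_hom fn_scale fn_mult scale mult (fn_eval f) \<and> (\<forall>v. fn_eval f (fn_gen v) = f v)"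
    by (simp add: novikov_hom_fn_eval fn_eval_gen)
qed (simp add: fn_eval_unique)

end

definition poly_circ :: "'k::field poly \<Rightarrow> 'k poly \<Rightarrow> 'k poly" where
  "poly_circ f g = pderiv f * g"

interpretation poly_circ: novikov_algebra smult poly_circ
  by unfold_locales
    (simp_all add: poly_circ_def pderiv_add pderiv_smult pderiv_mult algebra_simps
      smult_add_left smult_add_right)

end

theory Submission
  imports Defs
begin

text \<open>
  In \<open>k[x]\<close> with \<open>f \<circ> g = f' g\<close> every product of substituted polynomials is a combination of
  differential monomials of weight \<open>-1\<close>, that is, products of derivatives \<open>v\<^sup>(\<^sup>r\<^sup>)\<close> of the
  substituted polynomials in which the orders sum to the number of factors minus one. The theorem
  holds because the free Novikov algebra has no more elements than these monomials require: it is
  spanned by one word for each monomial, and the values of these words in \<open>k[x]\<close> are linearly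
  independent.

  Spanning. In any Novikov algebra the left multiplications commute; together they generate a
  commutative algebra of operators, on which the commutator with the right multiplication by \<open>a\<close>
  acts as a derivation, the abstract form of \<open>a \<partial>\<close>. Applying such derivations for generators
  to the left multiplication by a generator gives operators called factors, and the words
  obtained by applying factors to a generator span the algebra (\<open>eval_term_generated\<close>). Three kinds of
  rearrangement act on words. Factors commute. The outermost letters of two factors, or that of
  a factor and the final letter, can be exchanged (\<open>along_exchange\<close>, \<open>along_comp_exchange\<close>). Two
  letters inside one factor can be interchanged up to words with more factors
  (\<open>along_commutator\<close>). Hence words with the same differential monomial agree modulo words with more
  factors (\<open>word_cong_type\<close>). The number of factors is less than the number of letters, so one word
  chosen for each monomial suffices (\<open>word_span_subset_basis\<close>).

  Independence. The value of a word in \<open>k[x]\<close> is its differential monomial plus monomials with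
  more factors of positive order (\<open>word_poly\<close>). So a nontrivial combination of chosen words
  becomes a nontrivial combination of differential monomials. Since the Taylor coefficients
  at \<open>0\<close> of the substituted polynomials are arbitrary, such a combination is a nonzero polynomial
  in these coefficients and takes a nonzero value (\<open>diff_mon_independent\<close>).
\<close>

section \<open>Induction along rearrangements of a list\<close>

text \<open>Bubble sort as an induction principle. Transitivity may assume that the first two lists
  are rearrangements of each other, so that \<open>R\<close> can mention the length of its first argument.\<close>

lemma mset_eq_adjacent_swaps:
  assumes "mset xs = mset ys"
    and refl: "\<And>us. R us us"
    and trans: "\<And>us vs ws. mset us = mset vs \<Longrightarrow> R us vs \<Longrightarrow> R vs ws \<Longrightarrow> R us ws"
    and swap: "\<And>us a b vs. R (us @ a # b # vs) (us @ b # a # vs)"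
  shows "R xs ys"
  using assms
proof (induction xs arbitrary: ys R)
  case Nil
  then show ?case by simp
next
  case (Cons x xs)
  have "x \<in> set ys"
    using Cons.prems(1) by (metis list.set_intros(1) set_mset_mset)
  then obtain us vs where ys: "ys = us @ x # vs"
    by (meson split_list)
  have front: "R (x # us @ vs) (us @ x # vs)" for us vs
  proof (induction us arbitrary: vs rule: rev_induct)
    case Nil
    then show ?case by (simp add: Cons.prems(2))
  next
    case (snoc u us)
    have "R (x # us @ u # vs) (us @ x # u # vs)"
      using snoc[of "u # vs"] by simp
    moreover have "R (us @ x # u # vs) (us @ u # x # vs)"
      by (rule Cons.prems(4))
    ultimately show ?case
      using Cons.prems(3)[of "x # us @ u # vs" "us @ x # u # vs"] by simp
  qed
  have "mset xs = mset (us @ vs)"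
    using Cons.prems(1) ys by simp
  then have "R (x # xs) (x # (us @ vs))"
  proof (rule Cons.IH[where R = "\<lambda>p q. R (x # p) (x # q)"])
    show "R (x # p) (x # p)" for p
      by (rule Cons.prems(2))
    show "R (x # p) (x # r)" if "mset p = mset q" "R (x # p) (x # q)" "R (x # q) (x # r)" for p q r
      using that Cons.prems(3)[of "x # p" "x # q"] by simp
    show "R (x # p @ a # b # q) (x # p @ b # a # q)" for p a b q
      using Cons.prems(4)[of "x # p"] by simp
  qed
  then show ?case
    using Cons.prems(3)[of "x # xs" "x # us @ vs"] front Cons.prems(1) ys by simp
qed

section \<open>Words and differential monomials of weight -1\<close>

text \<open>A word is given by its shape, a list of pairs \<open>(v, r)\<close> (one factor each, with letter
  \<open>v\<close> and \<open>r\<close> further letters), and by one list of letters from which the factors take their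
  \<open>r\<close> letters in turn, leaving exactly one letter to act upon. A single flat list of letters
  makes the moves that exchange letters between different factors into swaps of neighbours.\<close>

definition proper_word :: "('v \<times> nat) list \<Rightarrow> 'v list \<Rightarrow> bool" where
  "proper_word sh zs \<longleftrightarrow> length zs = Suc (sum_list (map snd sh))"

text \<open>A multiset of pairs \<open>(v, r)\<close> stands for the differential monomial
  \<open>\<Prod> v\<^sup>(\<^sup>r\<^sup>)\<close>. The type of a word is the monomial with the fewest positive orders in its value in \<open>k[x]\<close>: a
  factor with \<open>r\<close> letters contributes a derivative of order \<open>r + 1\<close>.\<close>

definition word_type :: "('v \<times> nat) list \<Rightarrow> 'v list \<Rightarrow> ('v \<times> nat) multiset" where
  "word_type sh zs =
     image_mset (\<lambda>(v, r). (v, Suc r)) (mset sh) + image_mset (\<lambda>z. (z, 0)) (mset zs)"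

definition pos_count :: "('v \<times> nat) multiset \<Rightarrow> nat" where
  "pos_count M = size (filter_mset (\<lambda>(v, r). 0 < r) M)"

text \<open>These are the monomials of weight \<open>-1\<close>, where \<open>v\<^sup>(\<^sup>r\<^sup>)\<close> has weight \<open>r - 1\<close>.\<close>

definition realizable :: "('v \<times> nat) multiset set" where
  "realizable = {word_type sh zs |sh zs. proper_word sh zs}"

text \<open>The choice is made independently of any algebra, so that homomorphisms send the chosen
  words of one algebra to those of another.\<close>

definition chosen_word :: "('v \<times> nat) multiset \<Rightarrow> ('v \<times> nat) list \<times> 'v list" where
  "chosen_word M = (SOME (sh, zs). proper_word sh zs \<and> word_type sh zs = M)"

lemma chosen_word:
  assumes "M \<in> realizable" "chosen_word M = (sh, zs)"
  shows "proper_word sh zs" "word_type sh zs = M"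
proof -
  have "\<exists>p. case p of (sh, zs) \<Rightarrow> proper_word sh zs \<and> word_type sh zs = M"
    using assms(1) by (auto simp: realizable_def)
  from someI_ex[OF this] show "proper_word sh zs" "word_type sh zs = M"
    using assms(2) by (auto simp: chosen_word_def)
qed

text \<open>The shape is read off from the positive orders and the letters from the order \<open>0\<close>.\<close>

lemma word_type_eqD:
  assumes "word_type sh zs = word_type sh' zs'"
  shows "mset sh = mset sh'" "mset zs = mset zs'"
proof -
  have sh: "image_mset (\<lambda>(v, r). (v, r - 1)) (filter_mset (\<lambda>(v, r). 0 < r) (word_type sh zs)) = mset sh"
    for sh :: "('a \<times> nat) list" and zs
    by (simp add: word_type_def filter_mset_image_mset multiset.map_comp comp_def case_prod_unfold)
  have zs: "image_mset fst (filter_mset (\<lambda>(v, r). r = 0) (word_type sh zs)) = mset zs"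
    for sh :: "('a \<times> nat) list" and zs
    by (simp add: word_type_def filter_mset_image_mset multiset.map_comp comp_def case_prod_unfold)
  show "mset sh = mset sh'" "mset zs = mset zs'"
    using sh[of sh zs] sh[of sh' zs'] zs[of sh zs] zs[of sh' zs'] assms by auto
qed

lemma pos_count_word_type: "pos_count (word_type sh zs) = length sh"
  by (simp add: pos_count_def word_type_def filter_mset_image_mset comp_def case_prod_unfold)

section \<open>The algebra generated by the left multiplications\<close>

context novikov_algebra
begin

text \<open>The commutator with the right multiplication by \<open>a\<close>. If \<open>x \<circ> y = x' y\<close> and \<open>c\<close> is the
  multiplication by \<open>p\<close>, this is the multiplication by \<open>p' a\<close>: the operator \<open>along a\<close> plays
  the part of the derivation \<open>a \<partial>\<close> on coefficients.\<close>

definition along :: "'a \<Rightarrow> ('a \<Rightarrow> 'a) \<Rightarrow> 'a \<Rightarrow> 'a" where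
  "along a c = (\<lambda>x. mult (c x) a - c (mult x a))"

text \<open>In \<open>k[x]\<close> these operators are multiplications by differential polynomials of weight \<open>0\<close>.\<close>

inductive left_op :: "('a \<Rightarrow> 'a) \<Rightarrow> bool" where
  mult: "left_op (mult x)"
| add: "left_op c \<Longrightarrow> left_op d \<Longrightarrow> left_op (\<lambda>x. c x + d x)"
| scale: "left_op c \<Longrightarrow> left_op (\<lambda>x. scale r (c x))"
| comp: "left_op c \<Longrightarrow> left_op d \<Longrightarrow> left_op (\<lambda>x. c (d x))"

lemma left_op_linear:
  assumes "left_op c"
  shows "c (x + y) = c x + c y" "c (scale r x) = scale r (c x)"
  using assms
  by (induction arbitrary: x y rule: left_op.induct)
    (simp_all add: mult_add_right mult_scale_right scale_right_distrib mult.commute)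

lemma left_op_0:
  assumes "left_op c" shows "c 0 = 0"
  using left_op_linear(1)[OF assms, of 0 0] by simp

lemma left_op_diff:
  assumes "left_op c" shows "c (x - y) = c x - c y"
  using left_op_linear(1)[OF assms, of "x - y" y] by simp

lemma left_op_commute_mult:
  assumes "left_op c"
  shows "c (mult y x) = mult y (c x)"
  using assms
  by (induction arbitrary: x rule: left_op.induct)
    (simp_all add: left_commutative mult_add_right mult_scale_right)

text \<open>Left commutativity says that left multiplications commute with each other, hence so does
  everything they generate.\<close>

lemma left_op_commute:
  assumes "left_op c" "left_op d"
  shows "c (d x) = d (c x)"
  using assms(2)
  by (induction arbitrary: x rule: left_op.induct)
    (simp_all add: left_op_commute_mult left_op_linear assms(1))

lemma left_op_minus: "left_op c \<Longrightarrow> left_op d \<Longrightarrow> left_op (\<lambda>x. c x - d x)"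
  using left_op.add[OF _ left_op.scale[where r = "- 1"], of c d] by simp

lemma along_add: "along a (\<lambda>x. c x + d x) = (\<lambda>x. along a c x + along a d x)"
  by (simp add: along_def mult_add_left algebra_simps)

lemma along_scale: "along a (\<lambda>x. scale r (c x)) = (\<lambda>x. scale r (along a c x))"
  by (simp add: along_def mult_scale_left scale_right_diff_distrib)

lemma along_diff: "along a (\<lambda>x. c x - d x) = (\<lambda>x. along a c x - along a d x)"
  by (simp add: along_def mult_diff_left algebra_simps)

lemma along_comp:
  assumes "left_op c"
  shows "along a (\<lambda>x. c (d x)) = (\<lambda>x. along a c (d x) + c (along a d x))"
  by (simp add: along_def left_op_diff[OF assms])

lemma along_mult: "along y (mult x) = (\<lambda>z. mult (mult x y) z - mult x (mult y z))"
  using right_symmetric[of x _ y] by (simp add: along_def fun_eq_iff)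

text \<open>Right symmetry writes \<open>along y (mult x)\<close> as the left multiplication by \<open>xy\<close> minus the
  composition of those by \<open>x\<close> and \<open>y\<close>; the Leibniz rule does the rest.\<close>

lemma along_left_op:
  assumes "left_op c"
  shows "left_op (along a c)"
  using assms
proof induction
  case (mult x)
  show ?case
    unfolding along_mult
    by (rule left_op_minus[OF left_op.mult left_op.comp[OF left_op.mult left_op.mult]])
next
  case (comp c d)
  then show ?case
    using left_op.add[OF left_op.comp[OF comp.IH(1) comp.hyps(2)] left_op.comp[OF comp.hyps(1) comp.IH(2)]]
    by (simp only: along_comp[OF comp.hyps(1), of a d])
qed (simp_all add: along_add along_scale left_op.add left_op.scale)

text \<open>The counterpart of \<open>(x' y) \<partial> = x' (y \<partial>)\<close>, which reduces \<open>along\<close> to indices that are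
  generators.\<close>

lemma along_mult_index:
  assumes "left_op c"
  shows "along (mult x y) c = (\<lambda>u. mult x (along y c u))"
proof
  fix u
  show "along (mult x y) c u = mult x (along y c u)"
    using left_commutative[of "c u" x y] left_commutative[of u x y] left_commutative[of u x "c y"]
    by (simp add: along_def mult_diff_right left_op_commute_mult[OF assms])
qed

text \<open>In \<open>k[x]\<close> both sides are \<open>p' a b\<close>. For a left multiplication this is right symmetry.\<close>

lemma along_exchange:
  assumes "left_op c"
  shows "along a c b = along b c a"
  using assms
proof induction
  case (mult x)
  show ?case by (simp add: along_def right_symmetric)
next
  case (comp c d)
  have "along a c (d b) = along b c (d a)"
    using comp by (metis along_left_op left_op_commute)
  then show ?case
    using comp by (simp only: along_comp[OF comp.hyps(1), of _ d])
qed (simp_all add: along_add along_scale)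

text \<open>Both sides stand for \<open>p' q' a b x\<close>. The identity follows by using the argument \<open>x\<close> as
  an intermediary in three exchanges of the previous kind.\<close>

lemma along_comp_exchange:
  assumes "left_op c" "left_op d"
  shows "along a c (along b d x) = along b c (along a d x)"
proof -
  have "along a c (along b d x) = along x d (along a c b)"
    using assms by (metis along_exchange along_left_op left_op_commute)
  also have "\<dots> = along x d (along b c a)"
    using along_exchange[OF assms(1), of a b] by simp
  also have "\<dots> = along b c (along a d x)"
    using assms by (metis along_exchange along_left_op left_op_commute)
  finally show ?thesis .
qed

text \<open>The counterpart of \<open>[a \<partial>, b \<partial>] = a b' \<partial> - b a' \<partial>\<close>. Interchanging two letters inside
  a factor thus costs only products of two factors, which is what makes the filtration by the
  number of factors work.\<close>

lemma along_commutator: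
  assumes "left_op c"
  shows "along a (along b c) x - along b (along a c) x
    = mult b (along a c x) - mult a (along b c x)"
proof -
  have swap: "mult (mult u b) a - mult (mult u a) b = mult b (mult u a) - mult a (mult u b)" for u
    using right_symmetric[of u b a] left_commutative[of u b a] left_commutative[of u a b]
    by (simp add: algebra_simps)
  have "along a (along b c) x - along b (along a c) x
      = (mult (mult (c x) b) a - mult (mult (c x) a) b) - c (mult (mult x b) a - mult (mult x a) b)"
    by (simp add: along_def mult_diff_left left_op_diff[OF assms])
  also have "\<dots> = mult b (along a c x) - mult a (along b c x)"
    unfolding swap
    by (simp add: along_def mult_diff_right left_op_diff[OF assms] left_op_commute_mult[OF assms])
  finally show ?thesis .
qed

section \<open>Words modulo words with more factors\<close>

text \<open>In \<open>k[x]\<close> the factor of \<open>v\<close> and \<open>a\<^sub>1, \<dots>, a\<^sub>r\<close> is the multiplication by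
  \<open>v\<^sup>(\<^sup>r\<^sup>+\<^sup>1\<^sup>) a\<^sub>1 \<cdots> a\<^sub>r\<close> plus terms in which derivatives have moved from \<open>v\<close> to the letters.\<close>

primrec factor :: "('v \<Rightarrow> 'a) \<Rightarrow> 'v \<Rightarrow> 'v list \<Rightarrow> 'a \<Rightarrow> 'a" where
  "factor f v [] = mult (f v)"
| "factor f v (a # as) = along (f a) (factor f v as)"

lemma left_op_factor: "left_op (factor f v as)"
  by (induction as) (simp_all add: left_op.mult along_left_op)

text \<open>Linear combinations of products of at least \<open>j\<close> factors with at most \<open>m\<close> letters in total.\<close>

inductive word_op :: "('v \<Rightarrow> 'a) \<Rightarrow> nat \<Rightarrow> nat \<Rightarrow> ('a \<Rightarrow> 'a) \<Rightarrow> bool" for f where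
  factor: "word_op f 1 (Suc (length as)) (factor f v as)"
| zero: "word_op f j m (\<lambda>x. 0)"
| add: "word_op f j m c \<Longrightarrow> word_op f j m d \<Longrightarrow> word_op f j m (\<lambda>x. c x + d x)"
| scale: "word_op f j m c \<Longrightarrow> word_op f j m (\<lambda>x. scale r (c x))"
| comp: "word_op f i l c \<Longrightarrow> word_op f j m d \<Longrightarrow> word_op f (i + j) (l + m) (\<lambda>x. c (d x))"
| mono: "word_op f j m c \<Longrightarrow> i \<le> j \<Longrightarrow> m \<le> n \<Longrightarrow> word_op f i n c"

lemma word_op_diff:
  "word_op f j m c \<Longrightarrow> word_op f j m d \<Longrightarrow> word_op f j m (\<lambda>x. c x - d x)"
  using word_op.add[OF _ word_op.scale[where r = "- 1"], of f j m c d] by simp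

lemma left_op_zero: "left_op (\<lambda>x. 0)"
  using left_op.scale[OF left_op.mult, of 0] by simp

lemma word_op_left_op: "word_op f j m c \<Longrightarrow> left_op c"
  by (induction rule: word_op.induct)
    (simp_all add: left_op_factor left_op_zero left_op.add left_op.scale left_op.comp)

lemma along_word_op:
  assumes "word_op f j m c"
  shows "word_op f j (Suc m) (along (f a) c)"
  using assms
proof induction
  case (factor as v)
  show ?case using word_op.factor[of f "a # as" v] by simp
next
  case (zero j m)
  show ?case by (simp add: along_def word_op.zero)
next
  case (comp i l c j m d)
  have 1: "word_op f (i + j) (Suc (l + m)) (\<lambda>x. along (f a) c (d x))"
    using word_op.comp[OF comp.IH(1) comp.hyps(2)] by simp
  have 2: "word_op f (i + j) (Suc (l + m)) (\<lambda>x. c (along (f a) d x))"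
    using word_op.comp[OF comp.hyps(1) comp.IH(2)] by simp
  show ?case
    unfolding along_comp[OF word_op_left_op[OF comp.hyps(1)], of "f a" d] by (rule word_op.add[OF 1 2])
next
  case (mono j m c i n)
  then show ?case by (meson Suc_le_mono word_op.mono)
qed (simp_all add: along_add along_scale word_op.add word_op.scale)

text \<open>Each swap of neighbouring letters is a commutator of two \<open>along\<close> operators and so
  yields products of two factors; the outer letters are then distributed over these by the
  Leibniz rule, which does not lower the number of factors.\<close>

lemma factor_perm:
  assumes "mset as = mset bs"
  shows "word_op f 2 (Suc (length as)) (\<lambda>x. factor f v as x - factor f v bs x)"
proof (rule mset_eq_adjacent_swaps[OF assms])
  show "word_op f 2 (Suc (length us)) (\<lambda>x. factor f v us x - factor f v us x)" for us
    by (simp add: word_op.zero)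
  show "word_op f 2 (Suc (length us)) (\<lambda>x. factor f v us x - factor f v ws x)"
    if "mset us = mset vs" "word_op f 2 (Suc (length us)) (\<lambda>x. factor f v us x - factor f v vs x)"
      "word_op f 2 (Suc (length vs)) (\<lambda>x. factor f v vs x - factor f v ws x)" for us vs ws
    using word_op.add[OF that(2)] that(3) mset_eq_length[OF that(1)] by fastforce
  fix us a b vs
  show "word_op f 2 (Suc (length (us @ a # b # vs)))
      (\<lambda>x. factor f v (us @ a # b # vs) x - factor f v (us @ b # a # vs) x)"
  proof (induction us)
    case Nil
    have "word_op f 2 (Suc (length (a # b # vs)))
        (\<lambda>x. factor f b [] (factor f v (a # vs) x) - factor f a [] (factor f v (b # vs) x))"
      using word_op.comp[OF word_op.factor[of f "[]" b] word_op.factor[of f "a # vs" v]]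
        word_op.comp[OF word_op.factor[of f "[]" a] word_op.factor[of f "b # vs" v]]
      by (intro word_op_diff) (simp_all add: numeral_2_eq_2)
    then show ?case
      by (simp add: along_commutator left_op_factor)
  next
    case (Cons u us)
    then show ?case
      using along_word_op[OF Cons, of u] by (simp add: along_diff)
  qed
qed

fun word :: "('v \<Rightarrow> 'a) \<Rightarrow> ('v \<times> nat) list \<Rightarrow> 'v list \<Rightarrow> 'a" where
  "word f [] zs = f (hd zs)"
| "word f ((v, r) # sh) zs = factor f v (take r zs) (word f sh (drop r zs))"

text \<open>The filtration is in \<open>k\<close>, the least number of factors; the bound \<open>n\<close> on the number of letters
  makes it end, since a word with \<open>k\<close> factors has more than \<open>k\<close> letters.\<close>

definition word_span :: "('v \<Rightarrow> 'a) \<Rightarrow> nat \<Rightarrow> nat \<Rightarrow> 'a set" where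
  "word_span f k n = span {word f sh zs |sh zs.
     proper_word sh zs \<and> k \<le> length sh \<and> length sh + length zs \<le> n}"

lemma word_in_word_span:
  "proper_word sh zs \<Longrightarrow> k \<le> length sh \<Longrightarrow> length sh + length zs \<le> n \<Longrightarrow> word f sh zs \<in> word_span f k n"
  unfolding word_span_def by (rule span_base) blast

lemma word_span_mono:
  "i \<le> k \<Longrightarrow> m \<le> n \<Longrightarrow> word_span f k m \<subseteq> word_span f i n"
  unfolding word_span_def by (rule span_mono) fastforce

lemma word_span_linear:
  "0 \<in> word_span f k n"
  "x \<in> word_span f k n \<Longrightarrow> y \<in> word_span f k n \<Longrightarrow> x + y \<in> word_span f k n"
  "x \<in> word_span f k n \<Longrightarrow> y \<in> word_span f k n \<Longrightarrow> x - y \<in> word_span f k n"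
  "x \<in> word_span f k n \<Longrightarrow> scale r x \<in> word_span f k n"
  unfolding word_span_def by (simp_all add: span_zero span_add span_diff span_scale)

lemma factor_word_span:
  assumes "u \<in> word_span f k n"
  shows "factor f v as u \<in> word_span f (Suc k) (Suc (length as) + n)"
  using assms unfolding word_span_def[of f k n]
proof (induction rule: span_induct_alt)
  case base
  show ?case by (simp add: left_op_0[OF left_op_factor] word_span_linear)
next
  case (step r x y)
  then obtain sh zs where w: "x = word f sh zs" "proper_word sh zs" "k \<le> length sh"
    "length sh + length zs \<le> n" by blast
  have "word f ((v, length as) # sh) (as @ zs) \<in> word_span f (Suc k) (Suc (length as) + n)"
    by (rule word_in_word_span) (use w in \<open>auto simp: proper_word_def\<close>)
  with step w show ?case
    by (simp add: left_op_linear[OF left_op_factor] word_span_linear)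
qed

lemma word_op_word_span:
  assumes "word_op f j m c" "u \<in> word_span f k n"
  shows "c u \<in> word_span f (j + k) (m + n)"
  using assms
proof (induction arbitrary: u k n)
  case (factor as v)
  then show ?case using factor_word_span by fastforce
next
  case (comp i l c j m d)
  then show ?case by (metis add.assoc)
next
  case (mono j m c i n')
  then show ?case
    using word_span_mono[of "i + k" "j + k" "m + n" "n' + n" f] by auto
qed (simp_all add: word_span_linear)

text \<open>The first letter of a factor may be exchanged exactly with the first letter of the word it
  acts on, wherever that letter sits: in a later factor or in the final place.\<close>

lemma word_exchange_first:
  assumes "left_op c"
  shows "along (f a) c (word f sh (b # ys)) = along (f b) c (word f sh (a # ys))"
proof (induction sh)
  case Nil
  show ?case by (simp add: along_exchange[OF assms])
next
  case (Cons p sh)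
  obtain v r where p: "p = (v, r)" by force
  show ?case
  proof (cases r)
    case 0
    then show ?thesis
      using Cons p by (simp add: left_op_commute_mult along_left_op assms)
  next
    case (Suc s)
    then show ?thesis
      using p by (simp add: along_comp_exchange[OF assms left_op_factor])
  qed
qed

text \<open>Two neighbouring letters lie both behind the first factor, both in it, or on either side of
  its end. In the last case the letter inside is rotated to the front of the factor, exchanged,
  and rotated back.\<close>

lemma word_swap_letters:
  assumes "proper_word sh (us @ a # b # vs)"
  shows "word f sh (us @ a # b # vs) - word f sh (us @ b # a # vs)
    \<in> word_span f (Suc (length sh)) (length sh + length (us @ a # b # vs))"
  using assms
proof (induction sh arbitrary: us vs)
  case Nil
  then show ?case by (simp add: proper_word_def)
next
  case (Cons p sh)
  obtain v r where p: "p = (v, r)" by force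
  let ?N = "word_span f (Suc (length (p # sh))) (length (p # sh) + length (us @ a # b # vs))"
  have len: "length us + length vs + 1 = r + sum_list (map snd sh)"
    using Cons.prems p by (simp add: proper_word_def)
  consider "r \<le> length us" | "r = Suc (length us)" | "Suc (Suc (length us)) \<le> r"
    by linarith
  then show ?case
  proof cases
    case 1
    \<comment> \<open>Both letters lie behind the first factor.\<close>
    let ?us = "drop r us"
    have "word f sh (?us @ a # b # vs) - word f sh (?us @ b # a # vs)
        \<in> word_span f (Suc (length sh)) (length sh + length (?us @ a # b # vs))"
      by (rule Cons.IH) (use len 1 in \<open>simp add: proper_word_def\<close>)
    from factor_word_span[OF this, of v "take r us"] show ?thesis
      using 1 p by (simp add: left_op_diff[OF left_op_factor] min_absorb2)
  next
    case 2
    \<comment> \<open>The swap happens across the end of the first factor.\<close>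
    have rest: "word f sh (x # vs) \<in> word_span f (length sh) (length sh + Suc (length vs))" for x
      by (rule word_in_word_span) (use len 2 in \<open>simp_all add: proper_word_def\<close>)
    have rotate: "factor f v (us @ [x]) (word f sh (y # vs)) - factor f v (x # us) (word f sh (y # vs)) \<in> ?N"
      for x y
      using word_op_word_span[OF factor_perm[of "us @ [x]" "x # us" f v] rest[of y]] p
      by (simp add: numeral_2_eq_2 ac_simps)
    have "factor f v (us @ [a]) (word f sh (b # vs)) - factor f v (us @ [b]) (word f sh (a # vs)) \<in> ?N"
      using word_span_linear(3)[OF rotate[of a b] rotate[of b a]]
      by (simp add: word_exchange_first[OF left_op_factor[of f v us], of f a sh b vs])
    then show ?thesis
      using 2 p by simp
  next
    case 3
    \<comment> \<open>Both letters lie in the first factor, which keeps \<open>s\<close> letters after them.\<close>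
    then obtain s where r: "r = length us + (2 + s)"
      by (metis add_2_eq_Suc add_Suc_right le_iff_add add_Suc)
    have "word f sh (drop s vs) \<in> word_span f (length sh) (length sh + length (drop s vs))"
      by (rule word_in_word_span) (use len r in \<open>simp_all add: proper_word_def\<close>)
    from word_op_word_span[OF factor_perm[of "us @ a # b # take s vs" "us @ b # a # take s vs" f v] this]
    show ?thesis
      using p r len by (simp add: numeral_2_eq_2 min_def ac_simps split: if_splits)
  qed
qed

lemma word_perm_letters:
  assumes "proper_word sh zs" "mset zs = mset zs'"
  shows "word f sh zs - word f sh zs' \<in> word_span f (Suc (length sh)) (length sh + length zs)"
proof -
  let ?R = "\<lambda>us vs. proper_word sh us \<longrightarrow>
    word f sh us - word f sh vs \<in> word_span f (Suc (length sh)) (length sh + length us)"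
  have "?R zs zs'"
  proof (rule mset_eq_adjacent_swaps[OF assms(2)])
    show "?R us ws" if "mset us = mset vs" "?R us vs" "?R vs ws" for us vs ws
    proof
      assume us: "proper_word sh us"
      have l: "length us = length vs" using that(1) by (rule mset_eq_length)
      with us have "proper_word sh vs" by (simp add: proper_word_def)
      with that(2,3) us l show "word f sh us - word f sh ws
          \<in> word_span f (Suc (length sh)) (length sh + length us)"
        using word_span_linear(2)[of "word f sh us - word f sh vs" f _ _ "word f sh vs - word f sh ws"]
        by simp
    qed
  qed (use word_swap_letters in \<open>auto simp: word_span_linear\<close>)
  with assms(1) show ?thesis by blast
qed

text \<open>Factors commute, but interchanging them also moves their letters in the flat list;
  the permutation of letters puts these back.\<close>

lemma word_perm_shape:
  assumes "proper_word sh zs" "mset sh = mset sh'"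
  shows "word f sh zs - word f sh' zs \<in> word_span f (Suc (length sh)) (length sh + length zs)"
proof -
  let ?R = "\<lambda>sh sh'. \<forall>zs. proper_word sh zs \<longrightarrow>
    word f sh zs - word f sh' zs \<in> word_span f (Suc (length sh)) (length sh + length zs)"
  have "?R sh sh'"
  proof (rule mset_eq_adjacent_swaps[OF assms(2)])
    show "?R s u" if "mset s = mset t" "?R s t" "?R t u" for s t u
    proof (intro allI impI)
      fix zs
      assume zs: "proper_word s zs"
      have l: "length s = length t" using that(1) by (rule mset_eq_length)
      have "sum_list (map snd s) = sum_list (map snd t)"
        using that(1) by (metis mset_map sum_mset_sum_list)
      with zs have "proper_word t zs" by (simp add: proper_word_def)
      with that(2,3) zs l show "word f s zs - word f u zs
          \<in> word_span f (Suc (length s)) (length s + length zs)"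
        using word_span_linear(2)[of "word f s zs - word f t zs" f _ _ "word f t zs - word f u zs"]
        by simp
    qed
    show "?R (us @ p # q # vs) (us @ q # p # vs)" for us p q vs
    proof (induction us)
      case Nil
      show ?case
      proof (intro allI impI)
        fix zs
        assume zs: "proper_word ([] @ p # q # vs) zs"
        obtain v r w s where pq: "p = (v, r)" "q = (w, s)" by force
        \<comment> \<open>The letters in the order in which the interchanged factors take them.\<close>
        let ?zs = "take s (drop r zs) @ take r zs @ drop (s + r) zs"
        have len: "r + s \<le> length zs" using zs pq by (simp add: proper_word_def)
        have split: "zs = take r zs @ take s (drop r zs) @ drop (s + r) zs"
          by (metis append_take_drop_id drop_drop)
        have m: "mset ?zs = mset zs"
          by (subst (4) split) simp
        have "word f (p # q # vs) zs = word f (q # p # vs) ?zs"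
          using len left_op_commute[OF left_op_factor left_op_factor,
              of f v "take r zs" f w "take s (drop r zs)"]
          by (simp add: pq min_absorb2 add.commute)
        moreover have "word f (q # p # vs) ?zs - word f (q # p # vs) zs
            \<in> word_span f (Suc (length (q # p # vs))) (length (q # p # vs) + length ?zs)"
          by (rule word_perm_letters) (use zs m mset_eq_length[OF m] in \<open>auto simp: proper_word_def\<close>)
        ultimately show "word f ([] @ p # q # vs) zs - word f ([] @ q # p # vs) zs
            \<in> word_span f (Suc (length ([] @ p # q # vs))) (length ([] @ p # q # vs) + length zs)"
          using mset_eq_length[OF m] by simp
      qed
    next
      case (Cons t us)
      show ?case
      proof (intro allI impI)
        fix zs
        assume zs: "proper_word ((t # us) @ p # q # vs) zs"
        obtain v r where t: "t = (v, r)" by force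
        have len: "r \<le> length zs" using zs t by (simp add: proper_word_def)
        have "proper_word (us @ p # q # vs) (drop r zs)"
          using zs t by (simp add: proper_word_def)
        with Cons have "word f (us @ p # q # vs) (drop r zs) - word f (us @ q # p # vs) (drop r zs)
            \<in> word_span f (Suc (length (us @ p # q # vs))) (length (us @ p # q # vs) + length (drop r zs))"
          by blast
        from factor_word_span[OF this, of v "take r zs"]
        show "word f ((t # us) @ p # q # vs) zs - word f ((t # us) @ q # p # vs) zs
            \<in> word_span f (Suc (length ((t # us) @ p # q # vs))) (length ((t # us) @ p # q # vs) + length zs)"
          using t len by (simp add: left_op_diff[OF left_op_factor] min_absorb2)
      qed
    qed
  qed (simp add: word_span_linear)
  with assms(1) show ?thesis by blast
qed

text \<open>Words of equal type have shapes and letter lists that are rearrangements of each other.\<close>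

lemma word_cong_type:
  assumes "proper_word sh zs" "word_type sh zs = word_type sh' zs'"
  shows "word f sh zs - word f sh' zs' \<in> word_span f (Suc (length sh)) (length sh + length zs)"
proof -
  note ms = word_type_eqD[OF assms(2)]
  have l: "length sh = length sh'" using ms(1) by (rule mset_eq_length)
  have "sum_list (map snd sh) = sum_list (map snd sh')"
    using ms(1) by (metis mset_map sum_mset_sum_list)
  with assms(1) have "proper_word sh' zs" by (simp add: proper_word_def)
  from word_perm_letters[OF this ms(2)] word_perm_shape[OF assms(1) ms(1)] l show ?thesis
    using word_span_linear(2)[of "word f sh zs - word f sh' zs" f _ _ "word f sh' zs - word f sh' zs'"]
    by simp
qed

definition basis_word :: "('v \<Rightarrow> 'a) \<Rightarrow> ('v \<times> nat) multiset \<Rightarrow> 'a" where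
  "basis_word f M = (case chosen_word M of (sh, zs) \<Rightarrow> word f sh zs)"

text \<open>Replacing a word by the chosen one of its type leaves an error with more factors and no
  more letters. This is repeated until the number of factors exceeds what the letters allow.\<close>

lemma word_span_subset_basis: "word_span f k n \<subseteq> span (basis_word f ` realizable)"
proof (induction "n - k" arbitrary: k rule: less_induct)
  case less
  have "word f sh zs \<in> span (basis_word f ` realizable)"
    if w: "proper_word sh zs" "k \<le> length sh" "length sh + length zs \<le> n" for sh zs
  proof -
    let ?M = "word_type sh zs"
    have M: "?M \<in> realizable" using w by (auto simp: realizable_def)
    obtain sh' zs' where c: "chosen_word ?M = (sh', zs')" by force
    have "word f sh zs - basis_word f ?M \<in> word_span f (Suc (length sh)) (length sh + length zs)"
      using word_cong_type[OF w(1), of sh' zs' f] chosen_word[OF M c] c by (simp add: basis_word_def)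
    also have "\<dots> \<subseteq> word_span f (Suc (length sh)) n"
      using w by (intro word_span_mono) auto
    also have "\<dots> \<subseteq> span (basis_word f ` realizable)"
      using w by (intro less) (auto simp: proper_word_def)
    finally have "word f sh zs - basis_word f ?M \<in> span (basis_word f ` realizable)" .
    moreover have "basis_word f ?M \<in> span (basis_word f ` realizable)"
      using M by (intro span_base imageI)
    ultimately show ?thesis
      using span_add by fastforce
  qed
  then show ?case
    unfolding word_span_def by (intro span_minimal subspace_span) blast
qed

section \<open>Chosen words span the generated algebra\<close>

text \<open>For a product \<open>st\<close> of terms, the left multiplication by \<open>st\<close>, the operator \<open>along\<close> for the index
  \<open>st\<close> and the element \<open>st\<close> itself are all expressed through left multiplications and \<open>along\<close>
  operators of \<open>s\<close> and \<open>t\<close>; the three claims need one another.\<close>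

lemma eval_term_generated:
  "\<exists>m. word_op f 0 m (mult (eval_term f t))"
  "word_op f 0 m c \<Longrightarrow> \<exists>n. word_op f 0 n (along (eval_term f t) c)"
  "\<exists>n. eval_term f t \<in> word_span f 0 n"
proof (induction t arbitrary: c m)
  case (Var v)
  {
    case 1
    show ?case using word_op.mono[OF word_op.factor[of f "[]" v], of 0] by auto
  next
    case 2
    show ?case using along_word_op[OF 2, of v] by auto
  next
    case 3
    have "word f [] [v] \<in> word_span f 0 1"
      by (rule word_in_word_span) (simp_all add: proper_word_def)
    then show ?case by auto
  }
next
  case (Mul s t)
  obtain l where l: "word_op f 0 l (mult (eval_term f s))" using Mul.IH(1) by blast
  obtain m' where m': "word_op f 0 m' (mult (eval_term f t))" using Mul.IH(4) by blast
  {
    case 1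
    obtain n where n: "word_op f 0 n (along (eval_term f t) (mult (eval_term f s)))"
      using Mul.IH(5)[OF l] by blast
    have "word_op f 0 (l + m' + n)
        (\<lambda>x. mult (eval_term f s) (mult (eval_term f t) x)
          + along (eval_term f t) (mult (eval_term f s)) x)"
      using word_op.comp[OF l m'] n by (intro word_op.add) (auto elim: word_op.mono)
    then show ?case by (auto simp: along_mult)
  next
    case 2
    then obtain n where "word_op f 0 n (along (eval_term f t) c)" using Mul.IH(5) by blast
    then have "word_op f 0 (l + n) (\<lambda>x. mult (eval_term f s) (along (eval_term f t) c x))"
      using word_op.comp[OF l] by fastforce
    then show ?case
      using along_mult_index[OF word_op_left_op[OF 2]] by auto
  next
    case 3
    obtain n where "eval_term f t \<in> word_span f 0 n" using Mul.IH(6) by blast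
    from word_op_word_span[OF l this] show ?case by auto
  }
qed

lemma lin_ext_in_span:
  assumes "x \<in> span (b ` S)"
  shows "\<exists>p. Poly_Mapping.keys p \<subseteq> S \<and> x = lin_ext b p"
  using assms
proof (induction rule: span_induct_alt)
  case base
  show ?case by (rule exI[of _ 0]) (simp add: lin_ext_def)
next
  case (step r x y)
  then obtain s p where s: "s \<in> S" "x = b s" and p: "Poly_Mapping.keys p \<subseteq> S" "y = lin_ext b p"
    by blast
  have "Poly_Mapping.keys (Poly_Mapping.single s r + p) \<subseteq> S"
    using Poly_Mapping.keys_add[of "Poly_Mapping.single s r" p] s p by (auto split: if_splits)
  with s p show ?case
    by (intro exI[of _ "Poly_Mapping.single s r + p"]) (simp add: lin_ext_add)
qed

lemma lin_ext_eval_term_basis: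
  "\<exists>p. Poly_Mapping.keys p \<subseteq> realizable \<and> lin_ext (eval_term f) q = lin_ext (basis_word f) p"
proof (rule lin_ext_in_span)
  have "eval_term f t \<in> span (basis_word f ` realizable)" for t
    using eval_term_generated(3)[of f t] word_span_subset_basis by blast
  then show "lin_ext (eval_term f) q \<in> span (basis_word f ` realizable)"
    unfolding lin_ext_def by (intro span_sum span_scale)
qed

end

context novikov_hom
begin

lemma hom_factor: "\<phi> (A.factor g v as x) = B.factor (\<lambda>v. \<phi> (g v)) v as (\<phi> x)"
  by (induction as arbitrary: x) (simp_all add: hom_mult A.along_def B.along_def diff)

lemma hom_word: "\<phi> (A.word g sh zs) = B.word (\<lambda>v. \<phi> (g v)) sh zs"
  by (induction sh arbitrary: zs) (auto simp: hom_factor)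

lemma hom_lin_ext_basis_word:
  "\<phi> (A.lin_ext (A.basis_word g) p) = B.lin_ext (B.basis_word (\<lambda>v. \<phi> (g v))) p"
  by (simp add: A.lin_ext_def B.lin_ext_def A.basis_word_def B.basis_word_def sum scale hom_word
      case_prod_unfold)

end

text \<open>Every element of the free algebra is its own value under the substitution of the generators
  for the letters.\<close>

lemma free_novikov_basis_expansion:
  fixes g :: "('v, 'k::field) free_novikov"
  shows "\<exists>p. Poly_Mapping.keys p \<subseteq> realizable \<and> g = fn.lin_ext (fn.basis_word fn_gen) p"
proof -
  have "novikov_hom fn_scale fn_mult fn_scale fn_mult (\<lambda>x::('v, 'k) free_novikov. x)"
    by unfold_locales simp_all
  then have "(\<lambda>x::('v, 'k) free_novikov. x) = fn.fn_eval fn_gen"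
    by (rule fn.fn_eval_unique) simp
  then have "g = fn.lin_ext (fn.eval_term fn_gen) (rep_free_novikov g)"
    by (metis fn.fn_eval_def)
  then show ?thesis
    using fn.lin_ext_eval_term_basis[of fn_gen] by metis
qed


section \<open>Independence of differential monomials\<close>

text \<open>Dedekind's argument: from a relation evaluated at \<open>ba\<close>, subtract \<open>\<chi>\<^sub>j(b)\<close> times the relation
  at \<open>a\<close>. This removes \<open>\<chi>\<^sub>j\<close> and keeps \<open>\<chi>\<^sub>i\<close> for a \<open>b\<close> at which the two differ.\<close>

lemma monoid_characters_independent:
  fixes \<chi> :: "'i \<Rightarrow> 'm \<Rightarrow> 'k::field" and mul :: "'m \<Rightarrow> 'm \<Rightarrow> 'm"
  assumes "finite S"
    and mult: "\<And>i a b. i \<in> S \<Longrightarrow> \<chi> i (mul a b) = \<chi> i a * \<chi> i b"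
    and nonzero: "\<And>i. i \<in> S \<Longrightarrow> \<exists>a. \<chi> i a \<noteq> 0"
    and inj: "inj_on \<chi> S"
    and vanish: "\<And>a. (\<Sum>i\<in>S. c i * \<chi> i a) = 0"
    and "i \<in> S"
  shows "c i = 0"
  using assms
proof (induction S arbitrary: c i rule: finite_induct)
  case empty
  then show ?case by simp
next
  case (insert j S)
  have S0: "c i = 0" if i: "i \<in> S" for i
  proof -
    have "\<chi> i \<noteq> \<chi> j"
      using i insert.hyps(2) insert.prems(3) by (metis inj_on_contraD insertCI)
    then obtain b where b: "\<chi> i b \<noteq> \<chi> j b" by blast
    have "c i * (\<chi> i b - \<chi> j b) = 0"
    proof (rule insert.IH[where c = "\<lambda>i. c i * (\<chi> i b - \<chi> j b)"])
      fix a
      have "(\<Sum>i\<in>insert j S. c i * \<chi> i (mul b a)) = \<chi> j b * (\<Sum>i\<in>insert j S. c i * \<chi> i a)"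
        using insert.prems(4) by simp
      then show "(\<Sum>i\<in>S. c i * (\<chi> i b - \<chi> j b) * \<chi> i a) = 0"
        using insert.hyps insert.prems(1)
        by (simp add: sum_distrib_left algebra_simps sum_subtractf)
    qed (use insert.prems i in \<open>auto intro: inj_on_subset\<close>)
    with b show ?thesis by simp
  qed
  then have "c j * \<chi> j a = 0" for a
    using insert.prems(4)[of a] insert.hyps by simp
  then have "c j = 0"
    using insert.prems(2)[of j] by auto
  with S0 insert.prems(5) show ?case by auto
qed

definition diff_mon :: "('v \<times> nat) multiset \<Rightarrow> ('v \<Rightarrow> 'k::field poly) \<Rightarrow> 'k poly" where
  "diff_mon M f = (\<Prod>(v, r)\<in>#M. (pderiv ^^ r) (f v))"

lemma diff_mon_simps [simp]:
  "diff_mon {#} f = 1"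
  "diff_mon (add_mset (v, r) M) f = (pderiv ^^ r) (f v) * diff_mon M f"
  "diff_mon (M + N) f = diff_mon M f * diff_mon N f"
  by (simp_all add: diff_mon_def)

lemma pos_count_simps [simp]:
  "pos_count {#} = 0"
  "pos_count (add_mset (v, r) M) = (if 0 < r then Suc (pos_count M) else pos_count M)"
  "pos_count (M + N) = pos_count M + pos_count N"
  by (simp_all add: pos_count_def)

text \<open>Combinations of differential monomials with at least \<open>k\<close> factors of positive order, as
  functions of the substituted polynomials.\<close>

inductive diff_poly :: "nat \<Rightarrow> (('v \<Rightarrow> 'k::field poly) \<Rightarrow> 'k poly) \<Rightarrow> bool" where
  mon: "k \<le> pos_count M \<Longrightarrow> diff_poly k (diff_mon M)"
| zero: "diff_poly k (\<lambda>f. 0)"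
| add: "diff_poly k u \<Longrightarrow> diff_poly k w \<Longrightarrow> diff_poly k (\<lambda>f. u f + w f)"
| smult: "diff_poly k u \<Longrightarrow> diff_poly k (\<lambda>f. smult c (u f))"

lemma diff_poly_mono:
  assumes "diff_poly k u" "j \<le> k"
  shows "diff_poly j u"
  using assms by (induction rule: diff_poly.induct) (auto intro: diff_poly.intros)

lemma diff_poly_sum:
  "(\<And>i. i \<in> I \<Longrightarrow> diff_poly k (u i)) \<Longrightarrow> diff_poly k (\<lambda>f. \<Sum>i\<in>I. u i f)"
  by (induction I rule: infinite_finite_induct) (simp_all add: diff_poly.zero diff_poly.add)

lemma diff_poly_mult:
  fixes u w :: "('v \<Rightarrow> 'k::field poly) \<Rightarrow> 'k poly"
  assumes "diff_poly j u" "diff_poly k w"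
  shows "diff_poly (j + k) (\<lambda>f. u f * w f)"
  using assms
proof (induction arbitrary: k w rule: diff_poly.induct)
  case (mon j M)
  from mon(2,1) show ?case
  proof (induction rule: diff_poly.induct)
    case (mon k N)
    have "(\<lambda>f :: 'v \<Rightarrow> 'k poly. diff_mon M f * diff_mon N f) = diff_mon (M + N)"
      by (simp add: fun_eq_iff)
    moreover have "diff_poly (j + k) (diff_mon (M + N) :: ('v \<Rightarrow> 'k poly) \<Rightarrow> _)"
      using mon \<open>j \<le> pos_count M\<close> by (intro diff_poly.mon) simp
    ultimately show ?case by simp
  qed (simp_all add: diff_poly.zero diff_poly.add diff_poly.smult distrib_left)
qed (simp_all add: diff_poly.zero diff_poly.add diff_poly.smult distrib_right)

text \<open>Differentiating a product raises the order of one factor. The number of factors of positive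
  order cannot drop, and it is at least one afterwards.\<close>

lemma diff_poly_pderiv_mon:
  "diff_poly (max 1 (pos_count M)) (\<lambda>f :: 'v \<Rightarrow> 'k::field poly. pderiv (diff_mon M f))"
proof (induction M)
  case empty
  show ?case by (simp add: diff_poly.zero)
next
  case (add x M)
  obtain v r where x: "x = (v, r)" by force
  let ?k = "max 1 (pos_count (add_mset x M))"
  have 1: "diff_poly ?k (diff_mon (add_mset (v, Suc r) M) :: ('v \<Rightarrow> 'k poly) \<Rightarrow> _)"
    by (rule diff_poly.mon) (simp add: x)
  have "diff_poly (pos_count {#(v, r)#} + max 1 (pos_count M))
      (\<lambda>f :: 'v \<Rightarrow> 'k poly. diff_mon {#(v, r)#} f * pderiv (diff_mon M f))"
    by (rule diff_poly_mult[OF diff_poly.mon add]) simp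
  then have 2: "diff_poly ?k (\<lambda>f :: 'v \<Rightarrow> 'k poly. diff_mon {#(v, r)#} f * pderiv (diff_mon M f))"
    by (rule diff_poly_mono) (simp add: x)
  show ?case
    using diff_poly.add[OF 1 2] by (simp add: x pderiv_mult algebra_simps)
qed

lemma diff_poly_pderiv:
  assumes "diff_poly k u"
  shows "diff_poly k (\<lambda>f. pderiv (u f))"
  using assms
proof induction
  case (mon k M)
  then show ?case by (intro diff_poly_mono[OF diff_poly_pderiv_mon]) simp
qed (simp_all add: diff_poly.zero diff_poly.add diff_poly.smult pderiv_add pderiv_smult)

section \<open>Values of words in the polynomial algebra\<close>

text \<open>Stated with the product already written out: unfolding \<open>poly_circ\<close> elsewhere would also
  rewrite the parameter of the constant \<open>factor\<close>.\<close>

lemma factor_poly_simps: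
  "poly_circ.factor f v [] x = pderiv (f v) * x"
  "poly_circ.factor f v (a # as) x
    = pderiv (poly_circ.factor f v as x) * f a - poly_circ.factor f v as (pderiv x * f a)"
  unfolding poly_circ.factor.simps poly_circ.along_def by (simp_all add: poly_circ_def)

text \<open>With one more letter \<open>a\<close> the coefficient \<open>q\<close> becomes \<open>q' a\<close>. Differentiating the
  leading monomial at \<open>v\<close> gives the new leading monomial; differentiating it at a letter leaves a
  second factor of positive order.\<close>

lemma factor_poly:
  "\<exists>u. diff_poly 2 u \<and> (\<forall>(f :: 'v \<Rightarrow> 'k::field poly) x. poly_circ.factor f v as x =
     (diff_mon (add_mset (v, Suc (length as)) (image_mset (\<lambda>z. (z, 0)) (mset as))) f + u f) * x)"
proof (induction as)
  case Nil
  show ?case by (rule exI[of _ "\<lambda>f. 0"], unfold factor_poly_simps) (simp add: diff_poly.zero)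
next
  case (Cons a as)
  let ?Z = "image_mset (\<lambda>z. (z, 0)) (mset as)" and ?r = "Suc (length as)"
  obtain u where u: "diff_poly 2 u"
    "\<And>(f :: 'v \<Rightarrow> 'k poly) x. poly_circ.factor f v as x = (diff_mon (add_mset (v, ?r) ?Z) f + u f) * x"
    using Cons by blast
  have "diff_poly 2 (\<lambda>f :: 'v \<Rightarrow> 'k poly. diff_mon {#(v, ?r)#} f * pderiv (diff_mon ?Z f))"
    using diff_poly_mult[OF diff_poly.mon[of 1 "{#(v, ?r)#}"]
        diff_poly_mono[OF diff_poly_pderiv_mon, of 1 ?Z]]
    by (simp add: numeral_2_eq_2)
  from diff_poly_mult[OF diff_poly.mon[of 0 "{#(a, 0)#}"] diff_poly.add[OF this diff_poly_pderiv[OF u(1)]]]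
  have "diff_poly 2 (\<lambda>f. f a * ((pderiv ^^ ?r) (f v) * pderiv (diff_mon ?Z f) + pderiv (u f)))"
    by (simp add: numeral_2_eq_2)
  moreover have "poly_circ.factor f v (a # as) x
      = (diff_mon (add_mset (v, Suc ?r) (add_mset (a, 0) ?Z)) f
        + f a * ((pderiv ^^ ?r) (f v) * pderiv (diff_mon ?Z f) + pderiv (u f))) * x"
    for f :: "'v \<Rightarrow> 'k poly" and x
    unfolding factor_poly_simps u(2) by (simp add: pderiv_mult pderiv_add algebra_simps)
  ultimately show ?case
    unfolding list.size(4) mset.simps image_mset_add_mset add_Suc_right add_0_right One_nat_def
    by (intro exI conjI allI)
qed

text \<open>A word takes the value of its monomial up to monomials with more factors of positive order:
  the same filtration as for words in an arbitrary Novikov algebra.\<close>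

lemma word_poly:
  assumes "proper_word sh zs"
  shows "\<exists>u. diff_poly (Suc (length sh)) u \<and>
    (\<forall>f :: 'v \<Rightarrow> 'k::field poly. poly_circ.word f sh zs = diff_mon (word_type sh zs) f + u f)"
  using assms
proof (induction sh arbitrary: zs)
  case Nil
  then obtain z where "zs = [z]" by (auto simp: proper_word_def length_Suc_conv)
  then show ?case
    by (intro exI[of _ "\<lambda>f. 0"]) (simp add: word_type_def diff_poly.zero)
next
  case (Cons p sh)
  obtain v r where p: "p = (v, r)" by force
  let ?as = "take r zs" and ?zs = "drop r zs"
  let ?M = "add_mset (v, Suc (length ?as)) (image_mset (\<lambda>z. (z, 0)) (mset ?as))"
  let ?N = "word_type sh ?zs"
  have len: "length ?as = r" using Cons.prems p by (simp add: proper_word_def)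
  have "proper_word sh ?zs" using Cons.prems p by (simp add: proper_word_def)
  then obtain w where w: "diff_poly (Suc (length sh)) w"
    "\<And>f :: 'v \<Rightarrow> 'k poly. poly_circ.word f sh ?zs = diff_mon ?N f + w f"
    using Cons.IH by blast
  obtain u where u: "diff_poly 2 u"
    "\<And>(f :: 'v \<Rightarrow> 'k poly) x. poly_circ.factor f v ?as x = (diff_mon ?M f + u f) * x"
    using factor_poly[of v ?as] by blast
  have type: "word_type (p # sh) zs = ?M + ?N"
    unfolding p word_type_def using len
    by (subst (1) append_take_drop_id[of r zs, symmetric], subst mset_append) simp
  have M: "diff_poly 1 (diff_mon ?M :: ('v \<Rightarrow> 'k poly) \<Rightarrow> _)"
    by (rule diff_poly.mon) simp
  have N: "diff_poly (length sh) (diff_mon ?N :: ('v \<Rightarrow> 'k poly) \<Rightarrow> _)"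
    by (rule diff_poly.mon) (simp add: pos_count_word_type)
  have "diff_poly (Suc (length (p # sh))) (\<lambda>f. diff_mon ?M f * w f + u f * (diff_mon ?N f + w f))"
    using diff_poly_mult[OF M w(1)]
      diff_poly_mult[OF u(1) diff_poly.add[OF N diff_poly_mono[OF w(1)]]]
    by (intro diff_poly.add) simp_all
  moreover have "poly_circ.word f (p # sh) zs
      = diff_mon (word_type (p # sh) zs) f
        + (diff_mon ?M f * w f + u f * (diff_mon ?N f + w f))" for f
    unfolding type unfolding p poly_circ.word.simps u(2) w(2) diff_mon_simps(3) by (simp only: algebra_simps)
  ultimately show ?case by blast
qed

lemma diff_poly_lin_ext:
  assumes "diff_poly k u"
  shows "\<exists>p. Poly_Mapping.keys p \<subseteq> {M. k \<le> pos_count M}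
    \<and> (\<forall>f. u f = poly_circ.lin_ext (\<lambda>M. diff_mon M f) p)"
  using assms
proof induction
  case (mon k M)
  then show ?case by (intro exI[of _ "Poly_Mapping.single M 1"]) simp
next
  case (zero k)
  show ?case by (rule exI[of _ 0]) (simp add: poly_circ.lin_ext_def)
next
  case (add k u w)
  then obtain p q where "Poly_Mapping.keys p \<subseteq> {M. k \<le> pos_count M}"
      "Poly_Mapping.keys q \<subseteq> {M. k \<le> pos_count M}"
      "\<forall>f. u f = poly_circ.lin_ext (\<lambda>M. diff_mon M f) p"
      "\<forall>f. w f = poly_circ.lin_ext (\<lambda>M. diff_mon M f) q" by blast
  then show ?case
    using Poly_Mapping.keys_add[of p q]
    by (intro exI[of _ "p + q"]) (auto simp: poly_circ.lin_ext_add)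
next
  case (smult k u c)
  then obtain p where "Poly_Mapping.keys p \<subseteq> {M. k \<le> pos_count M}"
      "\<forall>f. u f = poly_circ.lin_ext (\<lambda>M. diff_mon M f) p" by blast
  then show ?case
    by (intro exI[of _ "na_scale c p"]) (auto simp: poly_circ.lin_ext_scale in_keys_iff)
qed

text \<open>The values at \<open>0\<close> of the derivatives of a polynomial can be prescribed, up to any finite
  order, by Taylor's formula. Differential monomials at \<open>0\<close> therefore become monomials in
  independent scalars, which are characters of a multiplicative monoid of functions.\<close>

lemma diff_mon_independent:
  fixes p :: "('v \<times> nat) multiset \<Rightarrow>\<^sub>0 'k::field_char_0"
  assumes "p \<noteq> 0"
  shows "\<exists>f. poly_circ.lin_ext (\<lambda>M. diff_mon M f) p \<noteq> 0"
proof -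
  let ?S = "Poly_Mapping.keys p"
  define \<chi> :: "('v \<times> nat) multiset \<Rightarrow> ('v \<times> nat \<Rightarrow> 'k) \<Rightarrow> 'k"
    where "\<chi> M a = (\<Prod>x\<in>#M. a x)" for M a
  have inj: "inj_on \<chi> ?S"
  proof
    fix M N
    assume "\<chi> M = \<chi> N"
    \<comment> \<open>Doubling one coordinate recovers the multiplicity in characteristic \<open>0\<close>.\<close>
    have count: "\<chi> M (\<lambda>y. if y = x then 2 else 1) = 2 ^ count M x" for M x
      unfolding \<chi>_def by (induction M) simp_all
    have "(2::'k) ^ count M x = 2 ^ count N x" for x
      using \<open>\<chi> M = \<chi> N\<close> count by metis
    then have "(of_nat (2 ^ count M x) :: 'k) = of_nat (2 ^ count N x)" for x
      by simp
    then have "(2::nat) ^ count M x = 2 ^ count N x" for x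
      by (simp only: of_nat_eq_iff)
    then show "M = N" by (intro multiset_eqI) simp
  qed
  obtain M where M: "M \<in> ?S" using assms by fastforce
  obtain a where a: "(\<Sum>M\<in>?S. Poly_Mapping.lookup p M * \<chi> M a) \<noteq> 0"
  proof (rule ccontr)
    assume "\<not> thesis"
    with that have "(\<Sum>M\<in>?S. Poly_Mapping.lookup p M * \<chi> M a) = 0" for a by blast
    then have "Poly_Mapping.lookup p M = 0"
    proof (intro monoid_characters_independent[of ?S \<chi> "\<lambda>a b x. a x * b x" "Poly_Mapping.lookup p"])
      show "\<exists>a. \<chi> M a \<noteq> 0" for M
        by (rule exI[of _ "\<lambda>x. 1"]) (simp add: \<chi>_def)
      show "inj_on \<chi> ?S" by (rule inj)
    qed (simp_all add: \<chi>_def prod_mset.distrib M)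
    with M show False by (simp add: in_keys_iff)
  qed
  \<comment> \<open>A bound for the orders that occur in \<open>p\<close>.\<close>
  define d where "d = Max (snd ` (\<Union>M\<in>?S. set_mset M))"
  have d: "r \<le> d" if "M \<in> ?S" "(v, r) \<in># M" for M v r
    unfolding d_def by (rule Max_ge) (use that in force)+
  define f :: "'v \<Rightarrow> 'k poly" where "f v = (\<Sum>j\<le>d. monom (a (v, j) / fact j) j)" for v
  have jet: "poly ((pderiv ^^ r) (f v)) 0 = a (v, r)" if "r \<le> d" for v r
    using that
    by (simp add: poly_0_coeff_0 coeff_higher_pderiv f_def coeff_sum pochhammer_fact[symmetric]
        if_distrib cong: if_cong)
  have "poly (diff_mon M f) 0 = \<chi> M a" if "M \<in> ?S" for M
  proof -
    have "poly (diff_mon M f) 0 = (\<Prod>(v, r)\<in>#M. poly ((pderiv ^^ r) (f v)) 0)"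
      by (induction M) (auto simp: diff_mon_def)
    also have "\<dots> = \<chi> M a"
      unfolding \<chi>_def using d[OF that] jet
      by (intro arg_cong[where f = prod_mset] image_mset_cong) auto
    finally show ?thesis .
  qed
  with a have "poly (poly_circ.lin_ext (\<lambda>M. diff_mon M f) p) 0 \<noteq> 0"
    by (simp add: poly_circ.lin_ext_def poly_sum)
  then show ?thesis by (intro exI[of _ f]) auto
qed

lemma basis_word_poly:
  assumes "M \<in> realizable"
  shows "\<exists>u. diff_poly (Suc (pos_count M)) u \<and> (\<forall>f. poly_circ.basis_word f M = diff_mon M f + u f)"
proof -
  obtain sh zs where c: "chosen_word M = (sh, zs)" by force
  note w = chosen_word[OF assms c]
  show ?thesis
    using word_poly[OF w(1)] w(2) pos_count_word_type[of sh zs] by (simp add: poly_circ.basis_word_def c)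
qed

text \<open>A monomial \<open>M\<close> of \<open>p\<close> with the fewest factors of positive order cannot be cancelled by
  the correction terms \<open>q\<close>, all of which have more.\<close>

theorem theorem1:
  fixes g :: "('v::finite, 'k::field_char_0) free_novikov"
  assumes "g \<noteq> 0"
  shows "\<exists>\<phi> :: ('v, 'k) free_novikov \<Rightarrow> 'k poly.
    novikov_hom fn_scale fn_mult smult poly_circ \<phi> \<and> \<phi> g \<noteq> 0"
proof -
  obtain p where p: "Poly_Mapping.keys p \<subseteq> realizable"
    and g: "g = fn.lin_ext (fn.basis_word fn_gen) p"
    using free_novikov_basis_expansion by blast
  let ?S = "Poly_Mapping.keys p"
  have "p \<noteq> 0" using assms g by (auto simp: fn.lin_ext_def)
  then have "?S \<noteq> {}" by simp
  then obtain M where M: "M \<in> ?S" "\<And>N. N \<in> ?S \<Longrightarrow> pos_count M \<le> pos_count N"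
    using arg_min_if_finite[of ?S pos_count] by (metis finite_keys not_le)
  have "\<forall>N\<in>?S. \<exists>u. diff_poly (Suc (pos_count N)) u
      \<and> (\<forall>f :: 'v \<Rightarrow> 'k poly. poly_circ.basis_word f N = diff_mon N f + u f)"
    using basis_word_poly p by blast
  then obtain u where u: "\<And>N. N \<in> ?S \<Longrightarrow> diff_poly (Suc (pos_count N)) (u N)"
    "\<And>N f. N \<in> ?S \<Longrightarrow> poly_circ.basis_word f N = diff_mon N f + u N (f :: 'v \<Rightarrow> 'k poly)"
    by metis
  have "diff_poly (Suc (pos_count M)) (\<lambda>f. \<Sum>N\<in>?S. smult (Poly_Mapping.lookup p N) (u N f))"
    by (intro diff_poly_sum diff_poly.smult diff_poly_mono[OF u(1)]) (simp_all add: M(2))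
  then obtain q where q: "Poly_Mapping.keys q \<subseteq> {N. Suc (pos_count M) \<le> pos_count N}"
    "\<And>f. (\<Sum>N\<in>?S. smult (Poly_Mapping.lookup p N) (u N f)) = poly_circ.lin_ext (\<lambda>N. diff_mon N f) q"
    using diff_poly_lin_ext by blast
  have "Poly_Mapping.lookup q M = 0"
    using q(1) by (auto simp: in_keys_iff)
  with M(1) have "Poly_Mapping.lookup (p + q) M \<noteq> 0"
    by (simp add: lookup_add in_keys_iff)
  then have "p + q \<noteq> 0" by auto
  then obtain f :: "'v \<Rightarrow> 'k poly" where f: "poly_circ.lin_ext (\<lambda>N. diff_mon N f) (p + q) \<noteq> 0"
    using diff_mon_independent by blast
  interpret \<phi>: novikov_hom fn_scale fn_mult smult poly_circ "poly_circ.fn_eval f"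
    by (rule poly_circ.novikov_hom_fn_eval)
  have "poly_circ.fn_eval f g = poly_circ.lin_ext (poly_circ.basis_word f) p"
    unfolding g \<phi>.hom_lin_ext_basis_word by (simp add: poly_circ.fn_eval_gen)
  also have "\<dots> = poly_circ.lin_ext (\<lambda>N. diff_mon N f) p
      + (\<Sum>N\<in>?S. smult (Poly_Mapping.lookup p N) (u N f))"
    by (simp add: poly_circ.lin_ext_def u(2) smult_add_right sum.distrib)
  also have "\<dots> = poly_circ.lin_ext (\<lambda>N. diff_mon N f) (p + q)"
    by (simp add: q(2) poly_circ.lin_ext_add)
  finally have "poly_circ.fn_eval f g \<noteq> 0"
    using f by simp
  then show ?thesis
    using \<phi>.novikov_hom_axioms by blast
qed

end
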